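(* The stabilizer of $\langle s_{01}\rangle$ in $\mathrm{GL}_4(\mathbb K)$ is the stabilizer of the subspace $\langle b_0,b_1\rangle$ of $\mathbb K^4$: $$\mathrm{GL}_4(\mathbb K)_{\langle s_{01}\rangle}=\left\{\begin{pmatrix}A&B\\0&C\end{pmatrix}\ \middle|\ A,C\in\mathrm{GL}_2(\mathbb K),\ B\in\mathbb K^{2\times2}\right\}=\mathrm{GL}_4(\mathbb K)_{\langle s_{01}\rangle^\perp}.$$ The orbits of this stabilizer on $\mathbb K^4$ are represented by $0$, $b_0$, $b_2$; those on $\Lambda/\langle s_{01}\rangle$ are represented by $\langle s_{01}\rangle$, $s_{02}+\langle s_{01}\rangle$, $s_{02}+s_{13}+\langle s_{01}\rangle$, $s_{23}+\langle s_{01}\rangle$; and those on $\Lambda/\langle s_{01}\rangle^\perp$ by $\langle s_{01}\rangle^\perp$, $s_{23}+\langle s_{01}\rangle^\perp$.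
   Context: $\mathbb K$ is an arbitrary field; $X'$ denotes the transpose of a matrix $X$; $b_0,b_1,b_2,b_3$ is the standard basis of $\mathbb K^4$ (column vectors). $\Lambda=\mathbb K^4\wedge\mathbb K^4$ is the space of skew-symmetric $4\times4$ matrices over $\mathbb K$ with zero diagonal, and $s_{jk}:=b_jb_k'-b_kb_j'$ for $0\le j<k\le3$. The group $\mathrm{GL}_4(\mathbb K)$ acts on $\mathbb K^4$ naturally and on $\Lambda$ by $M.X:=MXM'$. For $U\le\Lambda$, $\mathrm{GL}_4(\mathbb K)_U$ is the stabilizer of $U$ under this action; it acts on $\Lambda/U$. $\langle\cdots\rangle$ denotes $\mathbb K$-span. The orthogonal space $U^\perp$ is taken with respect to the polar form of the Pfaffian quadratic form $\mathrm{pf}\bigl(\sum_{j<k}x_{jk}s_{jk}\bigr)=x_{01}x_{23}-x_{02}x_{13}+x_{03}x_{12}$. "The orbits are represented by" a list means that each orbit contains exactly one member of the list. *)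

theory Defs
  imports "HOL-Analysis.Analysis" "HOL-Algebra.Group_Action"
begin

text \<open>The index type \<open>4\<close> consists of the residues 0, 1, 2, 3, and the index type \<open>2\<close> of the
  residues 0, 1. Rows and columns are numbered from 0 here, unlike in \<^const>\<open>vector\<close>, for which
  \<open>0 = 4\<close> is the last index of \<open>4\<close>.\<close>

abbreviation b :: "4 \<Rightarrow> 'a::field^4" where
  "b j \<equiv> axis j 1"

definition s :: "4 \<Rightarrow> 4 \<Rightarrow> 'a::field^4^4" where
  "s j k = (columnvector (b j) :: 'a^1^4) ** transpose (columnvector (b k))
         - (columnvector (b k) :: 'a^1^4) ** transpose (columnvector (b j))"

definition Alt :: "('a::field^4^4) set"  (\<open>\<Lambda>\<close>) where
  "\<Lambda> = {X. transpose X = - X \<and> (\<forall>i. X $ i $ i = 0)}"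

text \<open>The library's scalar multiplication \<open>*s\<close> multiplies the components of a vector by elements
  of their own type, so on matrices scalars have to act entrywise by other means.\<close>

interpretation mat: vector_space "\<lambda>c::'a::field. map_matrix ((*) c) :: 'a^'m^'n \<Rightarrow> 'a^'m^'n"
  by unfold_locales (simp_all add: vec_eq_iff algebra_simps)

definition GL4 :: "('a::field^4^4) monoid" where
  "GL4 = \<lparr>carrier = {M. invertible M}, mult = (**), one = mat 1\<rparr>"

lemma group_GL4: "group (GL4 :: ('a::field^4^4) monoid)"
proof (rule groupI)
  fix M :: "'a^4^4" assume "M \<in> carrier GL4"
  then show "\<exists>N\<in>carrier GL4. N \<otimes>\<^bsub>GL4\<^esub> M = \<one>\<^bsub>GL4\<^esub>"
    unfolding GL4_def invertible_def by auto
next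
  show "\<one>\<^bsub>GL4\<^esub> \<in> carrier (GL4 :: ('a^4^4) monoid)"
    unfolding GL4_def invertible_def by (auto intro: exI[of _ "mat 1"])
qed (auto simp: GL4_def invertible_mult matrix_mul_assoc)

definition act :: "'a::field^4^4 \<Rightarrow> 'a^4^4 \<Rightarrow> 'a^4^4" where
  "act M X = M ** X ** transpose M"

text \<open>The \<open>4 \<times> 4\<close> matrix with first block row \<open>A B\<close> and second block row \<open>D C\<close>; \<open>r\<close> is the
  position of a row or column within its block.\<close>

definition block_mat :: "'a^2^2 \<Rightarrow> 'a^2^2 \<Rightarrow> 'a^2^2 \<Rightarrow> 'a^2^2 \<Rightarrow> 'a^4^4" where
  "block_mat A B D C = (\<chi> i j.
     let r = (\<lambda>l::4. if l \<in> {0, 2} then 0 else 1 :: 2) in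
     (if i \<in> {0, 1} then (if j \<in> {0, 1} then A else B)
      else (if j \<in> {0, 1} then D else C)) $ r i $ r j)"

definition pf :: "'a::field^4^4 \<Rightarrow> 'a" where
  "pf X = X $ 0 $ 1 * X $ 2 $ 3 - X $ 0 $ 2 * X $ 1 $ 3 + X $ 0 $ 3 * X $ 1 $ 2"

lemma pf_sum:
  "pf (map_matrix ((*) x01) (s 0 1) + map_matrix ((*) x02) (s 0 2) + map_matrix ((*) x03) (s 0 3)
     + map_matrix ((*) x12) (s 1 2) + map_matrix ((*) x13) (s 1 3) + map_matrix ((*) x23) (s 2 3))
   = x01 * x23 - x02 * x13 + x03 * x12"
  by (simp add: pf_def s_def matrix_matrix_mult_def columnvector_def transpose_def axis_def)

definition polar :: "'a::field^4^4 \<Rightarrow> 'a^4^4 \<Rightarrow> 'a" where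
  "polar X Y = pf (X + Y) - pf X - pf Y"

definition orth :: "('a::field^4^4) set \<Rightarrow> ('a^4^4) set" where
  "orth U = {X \<in> \<Lambda>. \<forall>Y\<in>U. polar X Y = 0}"

text \<open>A matrix stabilizing \<open>U\<close> acts on \<open>\<Lambda>/U\<close> by taking images of cosets under \<^const>\<open>act\<close>.\<close>

definition quot :: "('a::field^4^4) set \<Rightarrow> ('a^4^4) set set" where
  "quot U = (\<lambda>X. X +o U) ` \<Lambda>"

text \<open>Counting positions in the list rather than elements makes repetitions count.\<close>

definition orbits_represented_by ::
    "('g, 'c) monoid_scheme \<Rightarrow> 'x set \<Rightarrow> ('g \<Rightarrow> 'x \<Rightarrow> 'x) \<Rightarrow> 'x list \<Rightarrow> bool" where
  "orbits_represented_by G E \<phi> xs \<longleftrightarrow>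
     set xs \<subseteq> E \<and> (\<forall>C \<in> orbits G E \<phi>. \<exists>!i. i < length xs \<and> xs ! i \<in> C)"

end

theory Submission
  imports Defs
begin

text \<open>In \<open>2 \<times> 2\<close> blocks, an element of \<^term>\<open>\<Lambda>\<close> has diagonal blocks \<open>a J\<close>, \<open>c J\<close> and
  off-diagonal blocks \<open>Y\<close>, \<open>- Y'\<close>, where \<open>J\<close> has the rows \<open>(0, 1)\<close>, \<open>(- 1, 0)\<close>; the span of
  \<open>s\<^sub>0\<^sub>1\<close> is \<open>Y = 0, c = 0\<close> and its orthogonal space is \<open>c = 0\<close>. The block matrix \<open>(A B; 0 C)\<close>
  replaces \<open>Y\<close> by \<open>A Y C' + B (c J) C'\<close> and \<open>c\<close> by \<open>det C c\<close>. So for \<open>c \<noteq> 0\<close> one can reach \<open>c = 1\<close>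
  and clear \<open>Y\<close>, and for \<open>c = 0\<close> the rank of \<open>Y\<close> is a complete invariant modulo \<open>s\<^sub>0\<^sub>1\<close>. That a
  stabilizing matrix has the lower left block 0 follows from the vanishing of all but one of the
  \<open>2 \<times> 2\<close> minors of its first two columns (for the span) or of its last two rows (for the
  orthogonal space).\<close>

section \<open>Block matrices\<close>

lemma UNIV_4_from_0: "(UNIV :: 4 set) = {0, 1, 2, 3}"
  using UNIV_4 by auto

lemma UNIV_2_from_0: "(UNIV :: 2 set) = {0, 1}"
  using UNIV_2 by auto

lemma sum_4_from_0: "(\<Sum>i\<in>UNIV. f i) = f 0 + f 1 + f 2 + f (3 :: 4)"
  unfolding UNIV_4_from_0 by (simp add: add.assoc)

lemma sum_2_from_0: "(\<Sum>i\<in>UNIV. f i) = f 0 + f (1 :: 2)"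
  unfolding UNIV_2_from_0 by simp

lemma forall_4_from_0: "(\<forall>i :: 4. P i) \<longleftrightarrow> P 0 \<and> P 1 \<and> P 2 \<and> P 3"
proof -
  have "(\<forall>i. P i) \<longleftrightarrow> (\<forall>i\<in>UNIV. P i)" by simp
  then show ?thesis unfolding UNIV_4_from_0 by simp
qed

lemma forall_2_from_0: "(\<forall>i :: 2. P i) \<longleftrightarrow> P 0 \<and> P 1"
proof -
  have "(\<forall>i. P i) \<longleftrightarrow> (\<forall>i\<in>UNIV. P i)" by simp
  then show ?thesis unfolding UNIV_2_from_0 by simp
qed

lemma det_2_from_0: "det (A :: 'a::comm_ring_1^2^2) = A $ 0 $ 0 * A $ 1 $ 1 - A $ 0 $ 1 * A $ 1 $ 0"
proof -
  \<comment> \<open>\<open>det_2\<close> expands along the indices 1 and 2, and 2 is the residue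
    0.\<close>
  have "(2 :: 2) = 0" by simp
  then show ?thesis by (simp only: det_2) (simp add: algebra_simps)
qed

lemmas entries_4 = vec_eq_iff forall_4_from_0 matrix_matrix_mult_def sum_4_from_0 transpose_def
lemmas entries_2 = vec_eq_iff forall_2_from_0 matrix_matrix_mult_def sum_2_from_0 transpose_def

lemma invertible_mult_eq_0_left:
  assumes "invertible (A :: 'a::field^'n^'n)" "A ** Y = (0 :: 'a^'m^'n)"
  shows "Y = 0"
proof -
  obtain A' where "A' ** A = mat 1" using assms(1) unfolding invertible_def by blast
  then have "Y = A' ** (A ** Y)" by (simp add: matrix_mul_assoc)
  also have "\<dots> = 0" unfolding assms(2) by (simp add: matrix_matrix_mult_def vec_eq_iff)
  finally show ?thesis .
qed

lemma invertible_mult_eq_0_right: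
  assumes "invertible (A :: 'a::field^'n^'n)" "Y ** A = (0 :: 'a^'n^'m)"
  shows "Y = 0"
proof -
  obtain A' where "A ** A' = mat 1" using assms(1) unfolding invertible_def by blast
  then have "Y = (Y ** A) ** A'" by (simp flip: matrix_mul_assoc)
  also have "\<dots> = 0" unfolding assms(2) by (simp add: matrix_matrix_mult_def vec_eq_iff)
  finally show ?thesis .
qed

lemma block_mat_mult:
  "block_mat A B D C ** block_mat A' B' D' C' =
     block_mat (A ** A' + B ** D') (A ** B' + B ** C') (D ** A' + C ** D') (D ** B' + C ** C')"
  by (simp add: entries_4 block_mat_def Let_def sum_2_from_0 add.assoc)

lemma block_mat_transpose:
  "transpose (block_mat A B D C) = block_mat (transpose A) (transpose D) (transpose B) (transpose C)"
  by (simp add: entries_4 block_mat_def Let_def)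

lemma block_mat_add:
  "block_mat A B D C + block_mat A' B' D' C' = block_mat (A + A') (B + B') (D + D') (C + C')"
  by (simp add: entries_4 block_mat_def Let_def)

lemma block_mat_uminus: "- block_mat A B D C = block_mat (- A) (- B) (- D) (- C)"
  by (simp add: entries_4 block_mat_def Let_def)

lemma block_mat_eq_iff:
  "block_mat A B D C = block_mat A' B' D' C' \<longleftrightarrow> A = A' \<and> B = B' \<and> D = D' \<and> C = C'"
  by (auto simp add: entries_4 entries_2 block_mat_def Let_def)

lemma mat_1_block_mat: "mat 1 = block_mat (mat 1) 0 0 (mat 1)"
  by (simp add: entries_4 block_mat_def Let_def mat_def)

lemma block_mat_exhaust: obtains A B D C where "M = block_mat A B D C"
proof
  let ?hi = "\<lambda>i :: 2. if i = 0 then 0 else 1 :: 4" and ?lo = "\<lambda>i :: 2. if i = 0 then 2 else 3 :: 4"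
  show "M = block_mat (\<chi> i j. M $ ?hi i $ ?hi j) (\<chi> i j. M $ ?hi i $ ?lo j)
                      (\<chi> i j. M $ ?lo i $ ?hi j) (\<chi> i j. M $ ?lo i $ ?lo j)"
    by (simp add: entries_4 block_mat_def Let_def)
qed

section \<open>Skew-symmetric matrices in blocks\<close>

definition skew2 :: "'a::field \<Rightarrow> 'a^2^2" where
  "skew2 c = (\<chi> i j. if i = j then 0 else if i = 0 then c else - c)"

text \<open>Alternating matrices of size 2 form a line, on which congruence by \<open>A\<close> acts
  as the scalar \<open>det A\<close>.\<close>

lemma skew2_congruence: "A ** skew2 c ** transpose A = skew2 (det A * c)"
  by (simp add: entries_2 skew2_def det_2_from_0 algebra_simps)

lemma skew2_0 [simp]: "skew2 0 = 0"
  by (simp add: entries_2 skew2_def)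

lemma skew2_add: "skew2 c + skew2 d = skew2 (c + d)"
  by (simp add: entries_2 skew2_def)

text \<open>Meant for the mixed terms in the upper left block of a congruence, which are
  \<open>Z\<close> and minus its transpose.\<close>

lemma diff_transpose_skew2: "Z - transpose Z = skew2 (Z $ 0 $ 1 - Z $ 1 $ 0)"
  by (simp add: entries_2 skew2_def)

lemma transpose_skew2: "transpose (skew2 c) = - skew2 c"
  by (simp add: entries_2 skew2_def)

text \<open>Coordinates on \<open>\<Lambda>\<close>: \<open>a\<close> and \<open>c\<close> are the
  coefficients of \<open>s 0 1\<close> and \<open>s 2 3\<close>, and the rows of \<open>Y\<close>
  hold those of \<open>s 0 2\<close>, \<open>s 0 3\<close> and of \<open>s 1 2\<close>,
  \<open>s 1 3\<close>.\<close>

definition alt :: "'a::field \<Rightarrow> 'a^2^2 \<Rightarrow> 'a \<Rightarrow> 'a^4^4" where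
  "alt a Y c = block_mat (skew2 a) Y (- transpose Y) (skew2 c)"

lemma Alt_eq_alt: "\<Lambda> = {alt a Y c | a Y c. True}"
proof -
  have "transpose (alt a Y c) = - alt a Y c" for a :: 'a and Y c
    unfolding alt_def block_mat_transpose transpose_skew2 block_mat_uminus block_mat_eq_iff
    by (simp add: vec_eq_iff transpose_def)
  moreover have "alt a Y c $ i $ i = 0" for a :: 'a and Y c i
    by (simp add: alt_def skew2_def block_mat_def Let_def)
  ultimately have "alt a Y c \<in> \<Lambda>" for a :: 'a and Y c
    by (simp add: Alt_def)
  moreover have "\<exists>a Y c. X = alt a Y c" if "X \<in> \<Lambda>" for X :: "'a^4^4"
  proof -
    have skew: "X $ i $ j = - X $ j $ i" for i j
    proof -
      have "X $ i $ j = transpose X $ j $ i" by (simp add: transpose_def)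
      also have "transpose X = - X" using that by (simp add: Alt_def)
      finally show ?thesis by simp
    qed
    have "X $ i $ i = 0" for i
      using that by (simp add: Alt_def)
    with skew[of 1 0] skew[of 2 0] skew[of 3 0] skew[of 2 1] skew[of 3 1] skew[of 3 2]
    have "X = alt (X $ 0 $ 1) (\<chi> i j. X $ (if i = 0 then 0 else 1) $ (if j = 0 then 2 else 3)) (X $ 2 $ 3)"
      by (simp add: alt_def skew2_def block_mat_def Let_def entries_4)
    then show ?thesis by blast
  qed
  ultimately show ?thesis by auto
qed

lemma alt_add: "alt a Y c + alt a' Y' c' = alt (a + a') (Y + Y') (c + c')"
  by (simp add: alt_def block_mat_add block_mat_eq_iff skew2_add) (simp add: vec_eq_iff transpose_def)

lemma alt_diff: "alt a Y c - alt a' Y' c' = alt (a - a') (Y - Y') (c - c')"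
  by (simp add: alt_def skew2_def block_mat_def Let_def entries_4)

lemma alt_eq_iff: "alt a Y c = alt a' Y' c' \<longleftrightarrow> a = a' \<and> Y = Y' \<and> c = c'"
  by (auto simp: alt_def block_mat_eq_iff) (auto simp: skew2_def entries_2)

lemma alt_0: "0 = alt 0 0 0"
  by (simp add: alt_def skew2_def block_mat_def Let_def entries_4)

lemma s_entry: "s j k $ i $ l = b j $ i * b k $ l - b k $ i * b j $ l"
  by (simp add: s_def matrix_matrix_mult_def columnvector_def transpose_def)

lemma s_alt:
  "s 0 1 = alt 1 0 0" "s 2 3 = alt 0 0 1"
  "s 0 2 = alt 0 (\<chi> i j. if i = 0 \<and> j = 0 then 1 else 0) 0"
  "s 0 2 + s 1 3 = alt 0 (mat 1) 0"
  by (simp_all add: alt_def skew2_def block_mat_def Let_def entries_4 s_entry axis_def mat_def)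

text \<open>For \<open>c = 0\<close> the Pfaffian is \<open>- det Y\<close>, so it tells rank 2 of
  \<open>Y\<close> from smaller rank.\<close>

lemma pf_alt: "pf (alt a Y c) = a * c - det Y"
  by (simp add: pf_def alt_def skew2_def block_mat_def Let_def det_2_from_0)

lemma alt_2_3: "alt a Y c $ 2 $ 3 = c"
  by (simp add: alt_def skew2_def block_mat_def Let_def)

lemma span_s01: "mat.span {s 0 1} = {alt a 0 0 | a :: 'a::field. True}"
proof -
  have "map_matrix ((*) a) (s 0 1) = alt a 0 0" for a :: 'a
    by (simp add: s_alt alt_def skew2_def block_mat_def Let_def entries_4)
  then show ?thesis by (auto simp: mat.span_singleton)
qed

text \<open>Block multiplication yields three alternating summands in the upper left corner, each a
  multiple of \<open>skew2 1\<close>. That corner matters only up to the span of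
  \<open>s 0 1\<close>; the orbits are read off from the other two coordinates.\<close>

lemma act_alt:
  "act (block_mat A B 0 C) (alt a Y c) =
     alt (det A * a + det B * c + ((A ** Y ** transpose B) $ 0 $ 1 - (A ** Y ** transpose B) $ 1 $ 0))
       (A ** Y ** transpose C + B ** skew2 c ** transpose C) (det C * c)" (is "?L = alt ?a ?Y ?c")
proof -
  let ?Z = "A ** Y ** transpose B"
  have "?L = block_mat
      (A ** skew2 a ** transpose A + B ** skew2 c ** transpose B + (?Z - transpose ?Z))
      ?Y (- transpose ?Y) (C ** skew2 c ** transpose C)"
    unfolding act_def alt_def block_mat_transpose block_mat_mult block_mat_eq_iff
    by (intro conjI; simp add: entries_2 skew2_def; algebra)
  also have "\<dots> = alt ?a ?Y ?c"
    unfolding skew2_congruence diff_transpose_skew2 skew2_add alt_def ..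
  finally show ?thesis .
qed

text \<open>The polar form pairs the coordinate \<open>a\<close> with \<open>c\<close> alone, so
  orthogonality to \<open>s 0 1\<close> means \<open>c = 0\<close>.\<close>

lemma orth_span_s01: "orth {alt a 0 0 | a :: 'a::field. True} = {alt a Y 0 | a Y. True}"
proof -
  have "polar (alt a Y c) (alt a' 0 0) = a' * c" for a a' c :: 'a and Y
    by (simp add: polar_def alt_add pf_alt algebra_simps det_2_from_0)
  then show ?thesis
    unfolding orth_def Alt_eq_alt by (force simp: alt_eq_iff)
qed

lemma act_mult: "act M (act N X) = act (M ** N) X"
  by (simp add: act_def matrix_transpose_mul matrix_mul_assoc)

lemma act_1: "act (mat 1) X = X"
  by (simp add: act_def)

lemma act_add: "act M (X + Y) = act M X + act M Y"
  by (simp add: act_def matrix_add_ldistrib vec_eq_iff matrix_matrix_mult_def algebra_simps sum.distrib)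

section \<open>Stabilizers\<close>

text \<open>The maximal parabolic subgroup fixing the plane of the first two coordinates, the common
  value of the three stabilizers.\<close>

definition parabolic :: "('a::field^4^4) set" where
  "parabolic = {block_mat A B 0 C | A B C. invertible A \<and> invertible C}"

lemma block_mat_parabolic_iff: "block_mat A B 0 C \<in> parabolic \<longleftrightarrow> invertible A \<and> invertible C"
  unfolding parabolic_def by (auto simp: block_mat_eq_iff)

text \<open>The inverse of a block triangular matrix is again block triangular, by the explicit
  formula for \<open>?N\<close>.\<close>

lemma parabolic_inverse:
  fixes M :: "'a::field^4^4"
  assumes "M \<in> parabolic"
  shows "\<exists>N\<in>parabolic. M ** N = mat 1 \<and> N ** M = mat 1"
proof -
  obtain A B C where M: "M = block_mat A B 0 C" and "invertible A" "invertible C"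
    using assms unfolding parabolic_def by blast
  then obtain A' C' where A': "A ** A' = mat 1" "A' ** A = mat 1"
    and C': "C ** C' = mat 1" "C' ** C = mat 1"
    unfolding invertible_def by blast
  let ?N = "block_mat A' (- (A' ** B ** C')) 0 C'"
  have "?N \<in> parabolic"
    using A' C' unfolding parabolic_def invertible_def by blast
  moreover have "M ** ?N = mat 1" 
  proof -
    have "A ** (A' ** B ** C') = B ** C'"
      by (simp add: matrix_mul_assoc A')
    moreover have "A ** - Z = - (A ** Z)" for Z :: "'a^2^2"
      by (simp add: vec_eq_iff matrix_matrix_mult_def sum_negf)
    ultimately show ?thesis
      unfolding M by (simp add: block_mat_mult mat_1_block_mat A' C')
  qed
  moreover have "?N ** M = mat 1"
    using \<open>M ** ?N = mat 1\<close> matrix_left_right_inverse by blast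
  ultimately show ?thesis by blast
qed

lemma parabolic_iff:
  "M \<in> parabolic \<longleftrightarrow>
     invertible M \<and> (\<forall>i\<in>{2, 3}. \<forall>j\<in>{0, 1}. M $ i $ j = (0 :: 'a::field))"
proof
  assume "M \<in> parabolic"
  then have "invertible M" using parabolic_inverse unfolding invertible_def by blast
  moreover from \<open>M \<in> parabolic\<close> have "\<forall>i\<in>{2, 3}. \<forall>j\<in>{0, 1}. M $ i $ j = 0"
    unfolding parabolic_def by (auto simp: block_mat_def Let_def)
  ultimately show "invertible M \<and> (\<forall>i\<in>{2, 3}. \<forall>j\<in>{0, 1}. M $ i $ j = 0)" ..
next
  assume *: "invertible M \<and> (\<forall>i\<in>{2, 3}. \<forall>j\<in>{0, 1}. M $ i $ j = 0)"
  obtain A B D C where M: "M = block_mat A B D C" by (rule block_mat_exhaust)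
  from * have "D = 0" unfolding M by (auto simp: block_mat_def Let_def entries_2)
  obtain N where N: "M ** N = mat 1" "N ** M = mat 1" using * unfolding invertible_def by blast
  obtain A' B' D' C' where N': "N = block_mat A' B' D' C'" by (rule block_mat_exhaust)
  \<comment> \<open>Since \<open>D = 0\<close>, the upper left block of \<open>N ** M\<close> and
    the lower right block of \<open>M ** N\<close> are single products. One-sided inverses suffice
    for square blocks.\<close>
  have "A' ** A = mat 1" "C ** C' = mat 1"
    using N unfolding M N' \<open>D = 0\<close> mat_1_block_mat block_mat_mult block_mat_eq_iff by simp_all
  then have "invertible A" "invertible C"
    using invertible_left_inverse invertible_right_inverse by blast+
  then show "M \<in> parabolic" unfolding parabolic_def M \<open>D = 0\<close> by blast
qed

text \<open>Stabilizing means \<open>f M\<close> followed by equality of image and set, but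
  \<open>parabolic\<close> contains inverses, so it is enough to check that \<open>S\<close> is
  mapped into itself. The action is left general to cover both column vectors and
  \<open>\<Lambda>\<close>.\<close>

lemma stabilizer_eq_parabolic:
  fixes f :: "'a::field^4^4 \<Rightarrow> 'x \<Rightarrow> 'x"
  assumes f_mult: "\<And>M N x. f M (f N x) = f (M ** N) x" and f_1: "\<And>x. f (mat 1) x = x"
    and "\<And>M x. M \<in> parabolic \<Longrightarrow> x \<in> S \<Longrightarrow> f M x \<in> S"
    and "\<And>M. invertible M \<Longrightarrow> (\<And>x. x \<in> S \<Longrightarrow> f M x \<in> S) \<Longrightarrow> M \<in> parabolic"
  shows "stabilizer GL4 (\<lambda>M. (`) (f M)) S = parabolic"
proof
  show "stabilizer GL4 (\<lambda>M. (`) (f M)) S \<subseteq> parabolic"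
    using assms(4) unfolding stabilizer_def GL4_def by auto
next
  have "f M ` S = S" if "M \<in> parabolic" for M :: "'a^4^4"
  proof
    show "f M ` S \<subseteq> S" using assms(3) that by blast
    obtain N where "N \<in> parabolic" "M ** N = mat 1"
      using parabolic_inverse \<open>M \<in> parabolic\<close> by blast
    then have "x = f M (f N x)" for x by (simp add: f_mult f_1)
    then show "S \<subseteq> f M ` S" using assms(3)[OF \<open>N \<in> parabolic\<close>] by blast
  qed
  then show "parabolic \<subseteq> stabilizer GL4 (\<lambda>M. (`) (f M)) S"
    unfolding stabilizer_def GL4_def using parabolic_iff by auto
qed

section \<open>The stabilizers of the plane, of the span of \<open>s 0 1\<close> and of its
  orthogonal space\<close>

lemma stabilizer_span_b0_b1:
  "stabilizer GL4 (\<lambda>M. (`) ((*v) M)) (vec.span {b 0, b 1 :: 'a::field^4}) = parabolic"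
proof -
  have span: "v \<in> vec.span {b 0, b 1 :: 'a^4} \<longleftrightarrow> v $ 2 = 0 \<and> v $ 3 = 0" for v
  proof
    assume "v \<in> vec.span {b 0, b 1 :: 'a^4}"
    then show "v $ 2 = 0 \<and> v $ 3 = 0"
      by (auto simp: vec.span_insert vec.span_singleton axis_def vec_eq_iff forall_4_from_0)
  next
    assume "v $ 2 = 0 \<and> v $ 3 = 0"
    then have v: "v = v $ 0 *s b 0 + v $ 1 *s b 1"
      by (simp add: vec_eq_iff forall_4_from_0 axis_def)
    show "v \<in> vec.span {b 0, b 1 :: 'a^4}"
      by (subst v) (intro vec.span_add vec.span_scale vec.span_base; simp)
  qed
  show ?thesis
  proof (rule stabilizer_eq_parabolic)
    fix M :: "'a^4^4" and v :: "'a^4"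
    assume "M \<in> parabolic" "v \<in> vec.span {b 0, b 1}"
    then show "M *v v \<in> vec.span {b 0, b 1}"
      by (simp add: span parabolic_iff matrix_vector_mult_def sum_4_from_0)
  next
    fix M :: "'a^4^4"
    assume M: "invertible M" "\<And>v. v \<in> vec.span {b 0, b 1} \<Longrightarrow> M *v v \<in> vec.span {b 0, b 1}"
    show "M \<in> parabolic"
      \<comment> \<open>The images of \<open>b 0\<close> and \<open>b 1\<close> are the first two
        columns of \<open>M\<close>.\<close>
      using M(1) M(2)[of "b 0"] M(2)[of "b 1"] unfolding span
      by (simp add: parabolic_iff matrix_vector_mult_def sum_4_from_0 axis_def)
  qed (simp_all add: matrix_vector_mul_assoc)
qed

text \<open>Geometrically, a vector parallel to two linearly independent vectors of the plane is
  zero.\<close>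

lemma parallel_eq_0:
  assumes "x0 * y1 = x1 * y0" "x0 * z1 = x1 * z0" "y0 * z1 - y1 * z0 \<noteq> (0 :: 'a::field)"
  shows "x0 = 0 \<and> x1 = 0"
proof -
  have "x0 * (y0 * z1 - y1 * z0) = 0" "x1 * (y0 * z1 - y1 * z0) = 0"
    using assms(1,2) by algebra+
  then show ?thesis using assms(3) by simp
qed

text \<open>Up to the factor \<open>a\<close>, these are the Pluecker coordinates of the plane
  spanned by the first two columns of \<open>M\<close>.\<close>

lemma act_alt_0_0_nth:
  "act M (alt a 0 0) $ i $ l = a * (M $ i $ 0 * M $ l $ 1 - M $ i $ 1 * M $ l $ 0)"
  by (simp add: act_def matrix_matrix_mult_def transpose_def sum_4_from_0 alt_def block_mat_def
      skew2_def Let_def algebra_simps)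

text \<open>This entry involves only rows 2 and 3 of \<open>M\<close>, so its coefficients as a
  linear form in the matrix acted upon are the minors \<open>m\<close> of these rows.\<close>

lemma act_alt_2_3:
  fixes M :: "'a::field^4^4"
  defines "m \<equiv> \<lambda>j k. M $ 2 $ j * M $ 3 $ k - M $ 2 $ k * M $ 3 $ j"
  shows "act M (alt a Y c) $ 2 $ 3 = a * m 0 1 + Y $ 0 $ 0 * m 0 2 + Y $ 0 $ 1 * m 0 3
    + Y $ 1 $ 0 * m 1 2 + Y $ 1 $ 1 * m 1 3 + c * m 2 3"
  by (simp add: m_def act_def matrix_matrix_mult_def transpose_def sum_4_from_0 alt_def block_mat_def
      skew2_def Let_def algebra_simps)

lemma act_in_Alt:
  assumes "X \<in> \<Lambda>"
  shows "act M X \<in> \<Lambda>"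
proof -
  have "transpose (act M X) = act M (transpose X)"
    by (simp add: act_def matrix_transpose_mul matrix_mul_assoc)
  also have "\<dots> = - act M X"
    using assms by (simp add: Alt_def act_def vec_eq_iff matrix_matrix_mult_def sum_negf)
  moreover obtain a Y c where X: "X = alt a Y c" using assms unfolding Alt_eq_alt by blast
  \<comment> \<open>Skew symmetry leaves the diagonal open in characteristic 2, hence the separate
    computation.\<close>
  have "act M X $ i $ i = 0" for i
    by (simp add: X act_def matrix_matrix_mult_def transpose_def sum_4_from_0 alt_def block_mat_def
        skew2_def Let_def algebra_simps)
  ultimately show ?thesis by (simp add: Alt_def)
qed

lemma stabilizer_span_s01:
  "stabilizer GL4 (\<lambda>M. (`) (act M)) {alt a 0 0 | a :: 'a::field. True} = parabolic"
proof (rule stabilizer_eq_parabolic)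
  fix M :: "'a^4^4" and X
  assume "M \<in> parabolic" "X \<in> {alt a 0 0 | a :: 'a. True}"
  then show "act M X \<in> {alt a 0 0 | a :: 'a. True}"
    unfolding parabolic_def by (auto simp: act_alt alt_eq_iff)
next
  fix M :: "'a^4^4"
  assume M: "invertible M"
    "\<And>X. X \<in> {alt a 0 0 | a :: 'a. True} \<Longrightarrow> act M X \<in> {alt a 0 0 | a :: 'a. True}"
  obtain a where a: "act M (alt 1 0 0) = alt a 0 0"
    using M(2)[of "alt 1 0 0"] by auto
  have minor: "M $ i $ 0 * M $ l $ 1 - M $ i $ 1 * M $ l $ 0 = alt a 0 0 $ i $ l" for i l
    using act_alt_0_0_nth[of M 1 i l] a by simp
  \<comment> \<open>Otherwise the invertible \<open>M\<close> would send \<open>s 0 1\<close> to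
    0.\<close>
  have "a \<noteq> 0"
  proof
    assume "a = 0"
    obtain N where "N ** M = mat 1" using M(1) unfolding invertible_def by blast
    then have "alt 1 0 0 = act N (act M (alt 1 0 0))" by (simp add: act_mult act_1)
    also have "\<dots> = act N (alt 0 0 0)" using a \<open>a = 0\<close> by simp
    also have "\<dots> = alt 0 0 0" by (simp add: act_def flip: alt_0)
    finally show False by (simp add: alt_eq_iff)
  qed
  then have "M $ 0 $ 0 * M $ 1 $ 1 - M $ 0 $ 1 * M $ 1 $ 0 \<noteq> 0"
    by (simp add: minor alt_def skew2_def block_mat_def Let_def)
  \<comment> \<open>Within the first two columns, rows 2 and 3 are parallel to both row 0 and row 1,
    which are independent by the minor just shown to be nonzero.\<close>
  moreover have "M $ i $ 0 * M $ l $ 1 = M $ i $ 1 * M $ l $ 0" if "i \<in> {2, 3}" "l \<in> {0, 1}" for i l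
    using minor[of i l] that by (auto simp: alt_def block_mat_def Let_def transpose_def)
  ultimately have "M $ i $ 0 = 0 \<and> M $ i $ 1 = 0" if "i \<in> {2, 3}" for i
    using that by (intro parallel_eq_0[of _ "M $ 0 $ 1" _ "M $ 0 $ 0" "M $ 1 $ 1" "M $ 1 $ 0"]) auto
  then show "M \<in> parabolic" using M(1) by (simp add: parabolic_iff)
qed (simp_all add: act_mult act_1)

lemma stabilizer_orth_span_s01:
  "stabilizer GL4 (\<lambda>M. (`) (act M)) {alt a Y 0 | (a :: 'a::field) Y. True} = parabolic"
proof (rule stabilizer_eq_parabolic)
  fix M :: "'a^4^4" and X
  assume "M \<in> parabolic" "X \<in> {alt a Y 0 | (a :: 'a) Y. True}"
  then show "act M X \<in> {alt a Y 0 | (a :: 'a) Y. True}"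
    unfolding parabolic_def by (auto simp: act_alt alt_eq_iff)
next
  fix M :: "'a^4^4"
  assume M: "invertible M"
    "\<And>X. X \<in> {alt a Y 0 | (a :: 'a) Y. True} \<Longrightarrow> act M X \<in> {alt a Y 0 | (a :: 'a) Y. True}"
  let ?m = "\<lambda>j k. M $ 2 $ j * M $ 3 $ k - M $ 2 $ k * M $ 3 $ j"
  have zero: "act M (alt a Y 0) $ 2 $ 3 = 0" for a Y
  proof -
    have "act M (alt a Y 0) \<in> {alt a Y 0 | (a :: 'a) Y. True}" by (rule M(2)) blast
    then show ?thesis by (auto simp: alt_2_3)
  qed
  let ?E = "\<lambda>p q. (\<chi> i j. if i = p \<and> j = q then 1 else 0) :: 'a^2^2"
  have minors: "?m 0 1 = 0" "?m 0 2 = 0" "?m 0 3 = 0" "?m 1 2 = 0" "?m 1 3 = 0"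
    \<comment> \<open>The five matrices form a basis of the space \<open>c = 0\<close>, and each
      isolates one minor.\<close>
    using zero[of 1 0] zero[of 0 "?E 0 0"] zero[of 0 "?E 0 1"] zero[of 0 "?E 1 0"] zero[of 0 "?E 1 1"]
    by (simp_all add: act_alt_2_3)
  obtain N where "M ** N = mat 1" using M(1) unfolding invertible_def by blast
  \<comment> \<open>If the sixth minor vanished too, the entry at 2, 3 would be 0 on the whole image
    of \<open>\<Lambda>\<close>, but \<open>s 2 3\<close> is the image of
    \<open>act N (s 2 3)\<close>.\<close>
  have "?m 2 3 \<noteq> 0"
  proof
    assume "?m 2 3 = 0"
    have "act N (alt 0 0 1) \<in> \<Lambda>"
      by (rule act_in_Alt) (auto simp: Alt_eq_alt)
    then obtain a Y c where N: "act N (alt 0 0 1) = alt a Y c" unfolding Alt_eq_alt by blast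
    have "1 = act M (act N (alt 0 0 1)) $ 2 $ 3"
      using \<open>M ** N = mat 1\<close> by (simp add: act_mult act_1 alt_2_3)
    also have "\<dots> = 0"
      unfolding N act_alt_2_3 minors \<open>?m 2 3 = 0\<close> by simp
    finally show False by simp
  qed
  then have "M $ 2 $ 2 * M $ 3 $ 3 - M $ 3 $ 2 * M $ 2 $ 3 \<noteq> 0"
    by (simp add: mult.commute)
  \<comment> \<open>The argument for the span of \<open>s 0 1\<close> with rows and columns
    exchanged: within the last two rows, columns 0 and 1 are parallel to the independent columns 2
    and 3.\<close>
  moreover have "M $ 2 $ j * M $ 3 $ k = M $ 3 $ j * M $ 2 $ k" if "j \<in> {0, 1}" "k \<in> {2, 3}" for j k
    using minors that by (auto simp: algebra_simps)
  ultimately have "M $ 2 $ j = 0 \<and> M $ 3 $ j = 0" if "j \<in> {0, 1}" for j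
    using that by (intro parallel_eq_0[of _ "M $ 3 $ 2" _ "M $ 2 $ 2" "M $ 3 $ 3" "M $ 2 $ 3"]) auto
  then show "M \<in> parabolic" using M(1) by (simp add: parabolic_iff)
qed (simp_all add: act_mult act_1)

section \<open>Orbits\<close>

text \<open>Moving every element into the list gives existence. Uniqueness comes from the invariant
  \<open>h\<close>: two listed members of one orbit share its value and so occupy the same
  position.\<close>

lemma orbits_represented_by_invariant:
  assumes "set xs \<subseteq> E"
    and "\<And>x. x \<in> E \<Longrightarrow> \<exists>g\<in>H. \<phi> g x \<in> set xs"
    and "\<And>g x. g \<in> H \<Longrightarrow> x \<in> E \<Longrightarrow> h (\<phi> g x) = h x"
    and "distinct (map h xs)"
  shows "orbits_represented_by (G\<lparr>carrier := H\<rparr>) E \<phi> xs"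
  unfolding orbits_represented_by_def
proof (intro conjI ballI)
  fix C assume "C \<in> orbits (G\<lparr>carrier := H\<rparr>) E \<phi>"
  then obtain x where x: "x \<in> E" and C: "C = {\<phi> g x | g. g \<in> H}"
    unfolding orbits_def orbit_def by auto
  obtain g where "g \<in> H" "\<phi> g x \<in> set xs" using assms(2) x by blast
  then obtain i where "i < length xs" "xs ! i \<in> C" unfolding C in_set_conv_nth by auto
  moreover have "j = i" if "j < length xs" "xs ! j \<in> C" for j
  proof -
    have "h (xs ! i) = h x" "h (xs ! j) = h x"
      using \<open>xs ! i \<in> C\<close> \<open>xs ! j \<in> C\<close> assms(3) x unfolding C by auto
    then have "map h xs ! i = map h xs ! j" using \<open>i < length xs\<close> that by simp
    then show ?thesis
      using assms(4) \<open>i < length xs\<close> that unfolding distinct_conv_nth length_map by metis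
  qed
  ultimately show "\<exists>!i. i < length xs \<and> xs ! i \<in> C" by blast
qed (fact assms(1))

text \<open>The first row of \<open>A\<close> rescales a nonzero coordinate of \<open>v\<close> to
  1, and the second row annihilates \<open>v\<close>.\<close>

lemma ex_invertible_to_b0:
  assumes "v \<noteq> (0 :: 'a::field^2)"
  shows "\<exists>A :: 'a^2^2. invertible A \<and> A *v v = axis 0 1"
proof (cases "v $ 0 = 0")
  case True
  then have "v $ 1 \<noteq> 0" using assms by (simp add: vec_eq_iff forall_2_from_0)
  let ?A = "(\<chi> i j. if i = 0 then (if j = 0 then 0 else inverse (v $ 1)) else (if j = 0 then 1 else 0)) :: 'a^2^2"
  have "invertible ?A" "?A *v v = axis 0 1"
    using \<open>v $ 1 \<noteq> 0\<close> True
    by (simp_all add: invertible_det_nz det_2_from_0 vec_eq_iff forall_2_from_0 matrix_vector_mult_def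
        sum_2_from_0 axis_def)
  then show ?thesis by blast
next
  case False
  let ?A = "(\<chi> i j. if i = 0 then (if j = 0 then inverse (v $ 0) else 0)
    else (if j = 0 then - v $ 1 else v $ 0)) :: 'a^2^2"
  have "invertible ?A" "?A *v v = axis 0 1"
    using False
    by (simp_all add: invertible_det_nz det_2_from_0 vec_eq_iff forall_2_from_0 matrix_vector_mult_def
        sum_2_from_0 axis_def)
  then show ?thesis by blast
qed

text \<open>The three normal forms correspond to the ranks 0, 1 and 2. In rank 1, \<open>Y\<close>
  is a column times a row, and both factors are moved to the first basis vector.\<close>

lemma normal_form_2x2:
  fixes Y :: "'a::field^2^2"
  shows "\<exists>A (C :: 'a^2^2). invertible A \<and> invertible C \<and>
    A ** Y ** transpose C \<in> {0, \<chi> i j. if i = 0 \<and> j = 0 then 1 else 0, mat 1}"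
proof -
  consider "Y = 0" | "det Y \<noteq> 0" | "Y \<noteq> 0" "det Y = 0" by blast
  then show ?thesis
  proof cases
    case 1
    then have "mat 1 ** Y ** transpose (mat 1 :: 'a^2^2) = 0" by simp
    moreover have "invertible (mat 1 :: 'a^2^2)" by (simp add: invertible_det_nz)
    ultimately show ?thesis by blast
  next
    case 2
    then obtain A where "A ** Y = mat 1" "Y ** A = mat 1"
      using invertible_det_nz unfolding invertible_def by blast
    then have "invertible A" "A ** Y ** transpose (mat 1 :: 'a^2^2) = mat 1" unfolding invertible_def by auto
    moreover have "invertible (mat 1 :: 'a^2^2)" by (simp add: invertible_det_nz)
    ultimately show ?thesis by blast
  next
    case 3
    obtain p q where "Y $ p $ q \<noteq> 0" using 3 by (auto simp: vec_eq_iff)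
    \<comment> \<open>The column and the row through the nonzero entry at \<open>p\<close>,
      \<open>q\<close>, the row scaled so that the product of the two is \<open>Y\<close>.\<close>
    define u where "u = (\<chi> i. Y $ i $ q)"
    define v where "v = (\<chi> j. Y $ p $ j / Y $ p $ q)"
    have "\<forall>i j p q. Y $ i $ j * Y $ p $ q = Y $ i $ q * Y $ p $ j"
      using 3 by (simp add: forall_2_from_0 det_2_from_0 algebra_simps)
    then have Y: "Y $ i $ j = u $ i * v $ j" for i j
      using \<open>Y $ p $ q \<noteq> 0\<close> unfolding u_def v_def by (simp add: field_simps)
    have "u $ p \<noteq> 0" "v $ q \<noteq> 0" using \<open>Y $ p $ q \<noteq> 0\<close> unfolding u_def v_def by simp_all
    then have "u \<noteq> 0" "v \<noteq> 0" by auto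
    then obtain A C :: "'a^2^2" where A: "invertible A" "A *v u = axis 0 1"
      and C: "invertible C" "C *v v = axis 0 1"
      using ex_invertible_to_b0[of u] ex_invertible_to_b0[of v] by blast
    have "(A ** Y ** transpose C) $ i $ j = (A *v u) $ i * (C *v v) $ j" for i j
      by (simp add: matrix_matrix_mult_def matrix_vector_mult_def transpose_def sum_2_from_0 Y algebra_simps)
    then have "A ** Y ** transpose C = (\<chi> i j. if i = 0 \<and> j = 0 then 1 else 0)"
      unfolding A(2) C(2) by (simp add: vec_eq_iff axis_def)
    then show ?thesis using A(1) C(1) by blast
  qed
qed

text \<open>Representatives and an invariant are found in \<open>\<Lambda>\<close> and passed to
  cosets. As \<open>h\<close> is constant on each coset, its image there is a singleton, which
  serves as the invariant of the coset.\<close>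

lemma orbits_quot:
  fixes V :: "('a::field^4^4) set"
  assumes V: "0 \<in> V" "\<And>X Y. X \<in> V \<Longrightarrow> Y \<in> V \<Longrightarrow> X - Y \<in> V" "V \<subseteq> \<Lambda>"
    and stab: "parabolic = stabilizer GL4 (\<lambda>M. (`) (act M)) V"
    and rep: "\<And>X. X \<in> \<Lambda> \<Longrightarrow> \<exists>M\<in>parabolic. \<exists>Z\<in>set Zs. act M X - Z \<in> V"
    and "set Zs \<subseteq> \<Lambda>"
    and h_act: "\<And>M X. M \<in> parabolic \<Longrightarrow> X \<in> \<Lambda> \<Longrightarrow> h (act M X) = h X"
    and h_V: "\<And>X Y. X \<in> \<Lambda> \<Longrightarrow> Y \<in> V \<Longrightarrow> h (X + Y) = h X"
    and "distinct (map h Zs)"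
  shows "orbits_represented_by (GL4\<lparr>carrier := parabolic\<rparr>) (quot V) (\<lambda>M. (`) (act M))
    (map (\<lambda>X. X +o V) Zs)"
proof (rule orbits_represented_by_invariant[where h = "\<lambda>K. h ` K"])
  have coset: "X +o W = (+) X ` W" for X :: "'a^4^4" and W
    unfolding elt_set_plus_def by blast
  have act_coset: "act M ` (X +o V) = act M X +o V" if "M \<in> parabolic" for M X
  proof -
    have "act M ` V = V" using that stab unfolding stabilizer_def by blast
    moreover have "act M ` (X +o V) = act M X +o act M ` V"
      by (simp add: coset image_image act_add)
    ultimately show ?thesis by simp
  qed
  have h_coset: "h ` (X +o V) = {h X}" if "X \<in> \<Lambda>" for X
    using h_V[OF that] V(1) unfolding elt_set_plus_def by (force simp: image_iff)
  show "set (map (\<lambda>X. X +o V) Zs) \<subseteq> quot V"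
    using \<open>set Zs \<subseteq> \<Lambda>\<close> unfolding quot_def by auto
  show "h ` (act M ` K) = h ` K" if "M \<in> parabolic" "K \<in> quot V" for M K
  proof -
    obtain X where "X \<in> \<Lambda>" "K = X +o V" using \<open>K \<in> quot V\<close> unfolding quot_def by blast
    then show ?thesis using that h_act by (simp only: act_coset h_coset act_in_Alt)
  qed
  show "\<exists>M\<in>parabolic. act M ` K \<in> set (map (\<lambda>X. X +o V) Zs)" if "K \<in> quot V" for K
  proof -
    obtain X where X: "X \<in> \<Lambda>" "K = X +o V" using \<open>K \<in> quot V\<close> unfolding quot_def by blast
    obtain M Z where M: "M \<in> parabolic" "Z \<in> set Zs" "act M X - Z \<in> V" using rep[OF X(1)] by blast
    have "act M X +o V = Z +o V"
    proof (intro equalityI subsetI)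
      fix W assume "W \<in> act M X +o V"
      then obtain Y where Y: "Y \<in> V" "W = act M X + Y" unfolding elt_set_plus_def by blast
      \<comment> \<open>A sum in disguise, since \<open>V\<close> is given as closed under
        differences.\<close>
      have "(act M X - Z) - (0 - Y) \<in> V" using V M Y by blast
      then have "Z + ((act M X - Z) - (0 - Y)) \<in> Z +o V" unfolding elt_set_plus_def by blast
      then show "W \<in> Z +o V" by (simp add: Y(2) add.commute)
    next
      fix W assume "W \<in> Z +o V"
      then obtain Y where Y: "Y \<in> V" "W = Z + Y" unfolding elt_set_plus_def by blast
      have "Y - (act M X - Z) \<in> V" using V M Y by blast
      then have "act M X + (Y - (act M X - Z)) \<in> act M X +o V" unfolding elt_set_plus_def by blast
      then show "W \<in> act M X +o V" by (simp add: Y(2) add.commute)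
    qed
    then have "act M ` K = Z +o V" using act_coset[OF M(1)] X(2) by simp
    then show ?thesis using M by auto
  qed
  have "map ((`) h) (map (\<lambda>X. X +o V) Zs) = map (\<lambda>x. {x}) (map h Zs)"
    unfolding map_map comp_def using \<open>set Zs \<subseteq> \<Lambda>\<close> by (intro map_cong refl h_coset) blast
  then show "distinct (map ((`) h) (map (\<lambda>X. X +o V) Zs))"
    using \<open>distinct (map h Zs)\<close> by (simp only:) (subst distinct_map, simp)
qed

section \<open>Normal forms and orbits in the two quotients of \<open>\<Lambda>\<close>\<close>

lemma ex_act_alt_nonzero:
  fixes c :: "'a::field"
  assumes "c \<noteq> 0"
  shows "\<exists>M\<in>parabolic. \<exists>a'. act M (alt a Y c) = alt a' 0 1"
proof -
  \<comment> \<open>Any \<open>C\<close> of determinant \<open>inverse c\<close> would scale the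
    lower right coordinate to 1.\<close>
  define C :: "'a^2^2" where "C = (\<chi> i j. if i \<noteq> j then 0 else if i = 0 then inverse c else 1)"
  have "det C * c = 1" using assms unfolding C_def by (simp add: det_2_from_0)
  then have "invertible C" by (auto simp: invertible_det_nz)
  \<comment> \<open>The square of \<open>skew2 1\<close> is \<open>- mat 1\<close>, so
    \<open>B = Y ** skew2 (inverse c)\<close> solves \<open>B ** skew2 c = - Y\<close> and clears
    the off-diagonal block.\<close>
  have cancel: "(Y ** skew2 (inverse c)) ** skew2 c = - Y"
    using assms by (simp add: entries_2 skew2_def)
  have "mat 1 ** Y ** transpose C + (Y ** skew2 (inverse c)) ** skew2 c ** transpose C = 0"
    unfolding cancel by (simp add: entries_2 mat_def)
  then have "\<exists>a'. act (block_mat (mat 1) (Y ** skew2 (inverse c)) 0 C) (alt a Y c) = alt a' 0 1"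
    using \<open>det C * c = 1\<close> by (auto simp: act_alt)
  moreover have "block_mat (mat 1) (Y ** skew2 (inverse c)) 0 C \<in> parabolic"
    using \<open>invertible C\<close> by (simp add: block_mat_parabolic_iff invertible_det_nz)
  ultimately show ?thesis by blast
qed

lemma ex_act_alt_zero:
  "\<exists>M\<in>parabolic. \<exists>a'. \<exists>Y'\<in>{0, \<chi> i j. if i = 0 \<and> j = 0 then 1 else 0, mat 1}.
     act M (alt a Y 0) = alt a' Y' 0"
proof -
  obtain A C :: "'a^2^2" where "invertible A" "invertible C"
    and *: "A ** Y ** transpose C \<in> {0, \<chi> i j. if i = 0 \<and> j = 0 then 1 else 0, mat 1}"
    using normal_form_2x2 by blast
  then have "block_mat A 0 0 C \<in> parabolic" unfolding parabolic_def by blast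
  moreover have "act (block_mat A 0 0 C) (alt a Y 0) = alt (det A * a) (A ** Y ** transpose C) 0"
    unfolding act_alt alt_eq_iff by (simp add: entries_2 det_2_from_0)
  ultimately show ?thesis using * by blast
qed

lemma orbits_mod_span_s01:
  fixes U :: "('a::field^4^4) set"
  defines "U \<equiv> {alt a 0 0 | a. True}"
  shows "orbits_represented_by (GL4\<lparr>carrier := parabolic\<rparr>) (quot U) (\<lambda>M. (`) (act M))
    [U, s 0 2 +o U, (s 0 2 + s 1 3) +o U, s 2 3 +o U]"
proof -
  \<comment> \<open>The value is the rank of \<open>Y\<close> if \<open>c = 0\<close>, and 3
    otherwise, so the listed representatives take the values 0, 1, 2, 3 in order.\<close>
  define h :: "'a^4^4 \<Rightarrow> nat" where
    "h X = (if X $ 2 $ 3 \<noteq> 0 then 3 else if X \<in> U then 0 else if pf X = 0 then 1 else 2)" for X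
  have h_alt: "h (alt a Y c) = (if c \<noteq> 0 then 3 else if Y = 0 then 0 else if det Y = 0 then 1 else 2)"
    for a Y c unfolding h_def U_def by (simp add: alt_2_3 alt_eq_iff pf_alt)
  let ?E = "(\<chi> i j. if i = 0 \<and> j = 0 then 1 else 0) :: 'a^2^2"
  let ?Zs = "[alt 0 0 0, alt 0 ?E 0, alt 0 (mat 1) 0, alt 0 0 1 :: 'a^4^4]"
  have "?E \<noteq> 0" "det ?E = 0" "mat 1 \<noteq> (0 :: 'a^2^2)" "det (mat 1 :: 'a^2^2) = 1"
    by (auto simp: vec_eq_iff forall_2_from_0 det_2_from_0 mat_def)
  then have "distinct (map h ?Zs)" by (simp add: h_alt)
  have "orbits_represented_by (GL4\<lparr>carrier := parabolic\<rparr>) (quot U) (\<lambda>M. (`) (act M))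
      (map (\<lambda>X. X +o U) ?Zs)"
  proof (rule orbits_quot[where h = h])
    show "0 \<in> U" unfolding U_def alt_0 by blast
    show "X - Y \<in> U" if "X \<in> U" "Y \<in> U" for X Y
      using that unfolding U_def by (auto simp: alt_diff alt_eq_iff)
    show "U \<subseteq> \<Lambda>" "set ?Zs \<subseteq> \<Lambda>" unfolding U_def Alt_eq_alt by auto
    show "parabolic = stabilizer GL4 (\<lambda>M. (`) (act M)) U"
      unfolding U_def stabilizer_span_s01 ..
    show "h (X + Y) = h X" if "X \<in> \<Lambda>" "Y \<in> U" for X Y
      using that unfolding U_def Alt_eq_alt by (auto simp: alt_add h_alt)
    show "h (act M X) = h X" if "M \<in> parabolic" "X \<in> \<Lambda>" for M X
    proof -
      obtain A B C a Y c where M: "M = block_mat A B 0 C" "invertible A" "invertible C"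
        and X: "X = alt a Y c"
        using \<open>M \<in> parabolic\<close> \<open>X \<in> \<Lambda>\<close> unfolding parabolic_def Alt_eq_alt by blast
      have "det A \<noteq> 0" "det C \<noteq> 0" "invertible (transpose C)"
        using M by (simp_all add: invertible_det_nz)
      \<comment> \<open>Rank 0 is preserved by cancelling invertible factors; rank 2 is preserved
        because determinants multiply.\<close>
      moreover have "A ** Y ** transpose C = 0 \<longleftrightarrow> Y = 0"
      proof
        assume "A ** Y ** transpose C = 0"
        then have "A ** Y = 0" by (rule invertible_mult_eq_0_right[OF \<open>invertible (transpose C)\<close>])
        then show "Y = 0" by (rule invertible_mult_eq_0_left[OF M(2)])
      qed (simp add: entries_2)
      moreover have "A ** Y ** transpose C + B ** skew2 0 ** transpose C = A ** Y ** transpose C"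
        by (simp add: vec_eq_iff matrix_matrix_mult_def)
      ultimately show ?thesis
        unfolding M X act_alt h_alt by (cases "c = 0") (simp_all add: det_mul)
    qed
    show "\<exists>M\<in>parabolic. \<exists>Z\<in>set ?Zs. act M X - Z \<in> U" if "X \<in> \<Lambda>" for X
    proof -
      obtain a Y c where X: "X = alt a Y c" using \<open>X \<in> \<Lambda>\<close> unfolding Alt_eq_alt by blast
      have diff: "alt a Y c - alt 0 Y c \<in> U" for a Y c
        unfolding U_def by (auto simp: alt_diff alt_eq_iff)
      show ?thesis
      proof (cases "c = 0")
        case True
        then obtain M a' Y' where "M \<in> parabolic" "act M X = alt a' Y' 0" "Y' \<in> {0, ?E, mat 1}"
          using ex_act_alt_zero X by metis
        then show ?thesis using diff[of a' Y' 0] by - (rule rev_bexI[of M], auto)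
      next
        case False
        then obtain M a' where "M \<in> parabolic" "act M X = alt a' 0 1"
          using ex_act_alt_nonzero X by metis
        then show ?thesis using diff[of a' 0 1] by - (rule rev_bexI[of M], auto)
      qed
    qed
  qed (fact \<open>distinct (map h ?Zs)\<close>)
  then show ?thesis unfolding s_alt(4) by (simp add: s_alt(2,3) flip: alt_0)
qed

text \<open>Only the coordinate \<open>c\<close> survives in this quotient. It is multiplied by the
  nonzero \<open>det C\<close>, so whether it vanishes is the invariant.\<close>

lemma orbits_mod_orth_span_s01:
  fixes V :: "('a::field^4^4) set"
  defines "V \<equiv> {alt a Y 0 | a Y. True}"
  shows "orbits_represented_by (GL4\<lparr>carrier := parabolic\<rparr>) (quot V) (\<lambda>M. (`) (act M))
    [V, s 2 3 +o V]"
proof -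
  let ?Zs = "[alt 0 0 0, alt 0 0 1 :: 'a^4^4]"
  have "orbits_represented_by (GL4\<lparr>carrier := parabolic\<rparr>) (quot V) (\<lambda>M. (`) (act M))
      (map (\<lambda>X. X +o V) ?Zs)"
  proof (rule orbits_quot[where h = "\<lambda>X. X $ 2 $ 3 = 0"])
    show "0 \<in> V" unfolding V_def alt_0 by blast
    show "X - Y \<in> V" if "X \<in> V" "Y \<in> V" for X Y
      using that unfolding V_def by (auto simp: alt_diff alt_eq_iff)
    show "V \<subseteq> \<Lambda>" "set ?Zs \<subseteq> \<Lambda>" unfolding V_def Alt_eq_alt by auto
    show "parabolic = stabilizer GL4 (\<lambda>M. (`) (act M)) V"
      unfolding V_def stabilizer_orth_span_s01 ..
    show "((X + Y) $ 2 $ 3 = 0) = (X $ 2 $ 3 = 0)" if "X \<in> \<Lambda>" "Y \<in> V" for X Y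
      using that unfolding V_def by (auto simp: alt_2_3)
    show "(act M X $ 2 $ 3 = 0) = (X $ 2 $ 3 = 0)" if "M \<in> parabolic" "X \<in> \<Lambda>" for M X
      using that unfolding parabolic_def Alt_eq_alt by (auto simp: act_alt alt_2_3 invertible_det_nz)
    show "\<exists>M\<in>parabolic. \<exists>Z\<in>set ?Zs. act M X - Z \<in> V" if "X \<in> \<Lambda>" for X
    proof -
      obtain a Y c where X: "X = alt a Y c" using \<open>X \<in> \<Lambda>\<close> unfolding Alt_eq_alt by blast
      have diff: "alt a Y c - alt 0 0 c \<in> V" for a Y c
        unfolding V_def by (auto simp: alt_diff alt_eq_iff)
      show ?thesis
      proof (cases "c = 0")
        case True
        then obtain M a' Y' where "M \<in> parabolic" "act M X = alt a' Y' 0"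
          using ex_act_alt_zero X by metis
        then show ?thesis using diff[of a' Y' 0] by - (rule rev_bexI[of M], auto)
      next
        case False
        then obtain M a' where "M \<in> parabolic" "act M X = alt a' 0 1"
          using ex_act_alt_nonzero X by metis
        then show ?thesis using diff[of a' 0 1] by - (rule rev_bexI[of M], auto)
      qed
    qed
  qed (simp add: alt_2_3)
  then show ?thesis by (simp add: s_alt flip: alt_0)
qed

section \<open>Orbits on column vectors\<close>

definition block_vec :: "'a^2 \<Rightarrow> 'a^2 \<Rightarrow> 'a^4" where
  "block_vec u w = (\<chi> i. if i = 0 then u $ 0 else if i = 1 then u $ 1 else if i = 2 then w $ 0 else w $ 1)"

lemma block_mat_vec: "block_mat A B D C *v block_vec u w = block_vec (A *v u + B *v w) (D *v u + C *v w)"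
  by (simp add: vec_eq_iff forall_4_from_0 matrix_vector_mult_def sum_4_from_0 sum_2_from_0
      block_mat_def block_vec_def Let_def add.assoc)

lemma block_vec_eq_iff: "block_vec u w = block_vec u' w' \<longleftrightarrow> u = u' \<and> w = w'"
  by (auto simp add: vec_eq_iff forall_4_from_0 forall_2_from_0 block_vec_def)

lemma block_vec_exhaust: obtains u w where "v = block_vec u w"
proof
  show "v = block_vec (\<chi> i. if i = 0 then v $ 0 else v $ 1) (\<chi> i. if i = 0 then v $ 2 else v $ 3)"
    by (simp add: vec_eq_iff forall_4_from_0 block_vec_def)
qed

lemma block_vec_standard:
  "0 = block_vec 0 0" "b 0 = block_vec (axis 0 1) 0" "b 2 = block_vec 0 (axis 0 1)"
  by (simp_all add: vec_eq_iff forall_4_from_0 block_vec_def axis_def)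

text \<open>The invariant records whether the vector is 0 and whether it lies in the plane spanned
  by \<open>b 0\<close> and \<open>b 1\<close>.\<close>

lemma orbits_vectors:
  "orbits_represented_by (GL4\<lparr>carrier := parabolic\<rparr>) (UNIV :: ('a::field^4) set) (*v) [0, b 0, b 2]"
proof (rule orbits_represented_by_invariant[where h = "\<lambda>v. (v = 0, v $ 2 = 0 \<and> v $ 3 = 0)"])
  have lower: "block_vec u w $ 2 = 0 \<and> block_vec u w $ 3 = 0 \<longleftrightarrow> w = 0" for u w :: "'a^2"
    by (simp add: block_vec_def vec_eq_iff forall_2_from_0)
  fix M :: "'a^4^4" and v :: "'a^4"
  assume "M \<in> parabolic"
  then obtain A B C where M: "M = block_mat A B 0 C" "invertible A" "invertible C"
    unfolding parabolic_def by blast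
  obtain u w where v: "v = block_vec u w" by (rule block_vec_exhaust)
  have "A *v x = 0 \<longleftrightarrow> x = 0" "C *v x = 0 \<longleftrightarrow> x = 0" for x
    using M matrix_left_invertible_ker by (auto simp: invertible_left_inverse)
  then show "(M *v v = 0, (M *v v) $ 2 = 0 \<and> (M *v v) $ 3 = 0) = (v = 0, v $ 2 = 0 \<and> v $ 3 = 0)"
    unfolding M v block_mat_vec lower block_vec_standard(1) block_vec_eq_iff
    by (cases "w = 0") simp_all
next
  fix v :: "'a^4"
  obtain u w where v: "v = block_vec u w" by (rule block_vec_exhaust)
  have 1: "invertible (mat 1 :: 'a^2^2)" by (simp add: invertible_det_nz)
  consider "u = 0" "w = 0" | "u \<noteq> 0" "w = 0" | "w \<noteq> 0" by blast
  then show "\<exists>M\<in>parabolic. M *v v \<in> set [0, b 0, b 2]"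
  proof cases
    case 1
    have "mat 1 \<in> (parabolic :: ('a^4^4) set)"
      unfolding parabolic_def mat_1_block_mat using \<open>invertible (mat 1)\<close> by blast
    then show ?thesis using 1 v by (intro bexI[of _ "mat 1"]) (auto simp: block_vec_standard)
  next
    case 2
    obtain A :: "'a^2^2" where A: "invertible A" "A *v u = axis 0 1" using ex_invertible_to_b0 2 by blast
    have "block_mat A 0 0 (mat 1) \<in> parabolic" unfolding parabolic_def using A 1 by blast
    moreover have "block_mat A 0 0 (mat 1) *v v = b 0"
      unfolding v block_mat_vec block_vec_standard using A 2 by simp
    ultimately show ?thesis by force
  next
    case 3
    obtain C :: "'a^2^2" where C: "invertible C" "C *v w = axis 0 1" using ex_invertible_to_b0 3 by blast
    \<comment> \<open>Minus the column \<open>u\<close> times the first row of \<open>C\<close>. As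
      \<open>C *v w\<close> has first entry 1, this \<open>B\<close> sends \<open>w\<close> to
      \<open>- u\<close> and clears the upper half.\<close>
    define B where "B = (\<chi> i j. - (u $ i * C $ 0 $ j))"
    have "(B *v w) $ i = - u $ i * (C *v w) $ 0" for i
      by (simp add: B_def matrix_vector_mult_def sum_2_from_0 algebra_simps)
    then have "B *v w = - u" unfolding C by (simp add: vec_eq_iff)
    have "block_mat (mat 1) B 0 C \<in> parabolic" unfolding parabolic_def using C 1 by blast
    moreover have "block_mat (mat 1) B 0 C *v v = b 2"
      unfolding v block_mat_vec block_vec_standard using C \<open>B *v w = - u\<close> by simp
    ultimately show ?thesis by force
  qed
qed (simp_all add: axis_def vec_eq_iff forall_4_from_0)

theorem proposition4p1:
  fixes U :: "('a::field^4^4) set" and H :: "('a^4^4) set"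
  assumes "U = mat.span {s 0 1}"
    and "H = stabilizer GL4 (\<lambda>M. (`) (act M)) U"
  shows "H = stabilizer GL4 (\<lambda>M. (`) ((*v) M)) (vec.span {b 0, b 1}) \<and>
    H = {block_mat A B 0 C | A B C. invertible A \<and> invertible C} \<and>
    H = stabilizer GL4 (\<lambda>M. (`) (act M)) (orth U) \<and>
    orbits_represented_by (GL4\<lparr>carrier := H\<rparr>) UNIV (*v) [0, b 0, b 2] \<and>
    orbits_represented_by (GL4\<lparr>carrier := H\<rparr>) (quot U) (\<lambda>M. (`) (act M))
      [U, s 0 2 +o U, (s 0 2 + s 1 3) +o U, s 2 3 +o U] \<and>
    orbits_represented_by (GL4\<lparr>carrier := H\<rparr>) (quot (orth U)) (\<lambda>M. (`) (act M))
      [orth U, s 2 3 +o orth U]"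
proof -
  have U: "U = {alt a 0 0 | a. True}" unfolding assms(1) by (rule span_s01)
  have H: "H = parabolic" unfolding assms(2) U by (rule stabilizer_span_s01)
  have V: "orth U = {alt a Y 0 | a Y. True}" unfolding U by (rule orth_span_s01)
  show ?thesis
    unfolding V H unfolding U
    by (intro conjI stabilizer_span_b0_b1[symmetric] parabolic_def stabilizer_orth_span_s01[symmetric]
        orbits_vectors orbits_mod_span_s01 orbits_mod_orth_span_s01)
qed

end
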